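(* For a rooted tree $T$ with maximum degree $\Delta$, both the head level and the neck level of $T$ (with respect to $\Delta$) are bounded by $O(\log |V(T)|/\log \Delta)$.
   Context: A $k$-$L(2,1)$-labeling of a graph $G$ is a map $f:V(G)\to\{0,1,\ldots,k\}$ with $|f(x)-f(y)|\ge 2$ whenever $x,y$ are adjacent and $|f(x)-f(y)|\ge 1$ whenever $x,y$ are at distance $2$. For integers $h\ge 0$ let $L_h=\{h,h+1,\ldots,\Delta-h+1\}$. For a tree $T$ rooted at $v$ and a new vertex $u\notin V(T)$, let $T+(u,v)$ be $T$ with the added vertex $u$ and edge $(u,v)$; for labels $a,b$ set $\delta((u,v),(a,b))=1$ if $T+(u,v)$ has a $(\Delta+1)$-$L(2,1)$-labeling $f$ with $f(u)=a$, $f(v)=b$, and $0$ otherwise. $T$ is head-$L_h$-compatible if $\delta((u,v),(a,b))=\delta((u,v),(a',b))$ for all $a,a'\in L_h$, $b\in L_0$ with $|a-b|\ge2$, $|a'-b|\ge2$; neck-$L_h$-compatible if $\delta((u,v),(a,b))=\delta((u,v),(a,b'))$ for all $a\in L_0$, $b,b'\in L_h$ with $|a-b|\ge2$, $|a-b'|\ge2$. The neck (resp. head) level of $T$ is $0$ if $T$ is neck- (resp. head-) $L_0$-compatible, and is $h\ge 1$ if $T$ is not neck- (resp. head-) $L_{h-1}$-compatible but is neck- (resp. head-) $L_h$-compatible. *)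

theory Defs
  imports Complex_Main "Graph_Theory.Graph_Theory"
begin

text \<open>
  A finite simple graph is a \<open>pair_graph\<close>, in which every edge \<open>{x, y}\<close> is represented by the two
  arcs \<open>(x, y)\<close> and \<open>(y, x)\<close>. The constants \<open>forest\<close> and \<open>tree\<close> of Graph_Theory count the closed
  walk \<open>x, y, x\<close> as a cycle, so they do not describe undirected trees; an undirected cycle is a
  \<open>cycle\<close> of length at least 3.
\<close>

definition undirected_tree :: "'a pair_pre_digraph \<Rightarrow> bool" where
  "undirected_tree T \<longleftrightarrow> pair_graph T \<and> connected (with_proj T) \<and>
     \<not> (\<exists>p. pre_digraph.cycle (with_proj T) p \<and> 3 \<le> length p)"

definition rooted_tree :: "'a pair_pre_digraph \<Rightarrow> 'a \<Rightarrow> bool" where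
  "rooted_tree T v \<longleftrightarrow> undirected_tree T \<and> v \<in> pverts T"

definition max_degree :: "'a pair_pre_digraph \<Rightarrow> nat" where
  "max_degree G = Max (out_degree (with_proj G) ` pverts G)"

text \<open>Distance is the least number of arcs of a walk, infinite if there is no walk.\<close>

definition graph_dist :: "'a pair_pre_digraph \<Rightarrow> 'a \<Rightarrow> 'a \<Rightarrow> ereal" where
  "graph_dist G x y = wf_digraph.\<mu> (with_proj G) (\<lambda>_. 1) x y"

definition L21_labeling :: "nat \<Rightarrow> 'a pair_pre_digraph \<Rightarrow> ('a \<Rightarrow> nat) \<Rightarrow> bool" where
  "L21_labeling k G f \<longleftrightarrow>
     (\<forall>x \<in> pverts G. f x \<in> {0..k}) \<and>
     (\<forall>x \<in> pverts G. \<forall>y \<in> pverts G.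
        (x, y) \<in> parcs G \<longrightarrow> \<bar>int (f x) - int (f y)\<bar> \<ge> 2) \<and>
     (\<forall>x \<in> pverts G. \<forall>y \<in> pverts G.
        graph_dist G x y = 2 \<longrightarrow> \<bar>int (f x) - int (f y)\<bar> \<ge> 1)"

text \<open>
  In the following, \<open>D\<close> plays the role of \<open>\<Delta>\<close>. The upper end of \<open>L\<^sub>h\<close> is written \<open>D + 1 - h\<close> so that
  truncated subtraction is harmless: for \<open>h > D + 1\<close> the set is empty, as it should be.
\<close>

definition L_set :: "nat \<Rightarrow> nat \<Rightarrow> nat set" where
  "L_set D h = {h..D + 1 - h}"

definition add_pendant :: "'a pair_pre_digraph \<Rightarrow> 'a \<Rightarrow> 'a \<Rightarrow> 'a pair_pre_digraph" where
  "add_pendant T u v =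
     \<lparr> pverts = insert u (pverts T), parcs = parcs T \<union> {(u, v), (v, u)} \<rparr>"

text \<open>
  All notions below are meant for a new vertex \<open>u \<notin> pverts T\<close> and a root \<open>v \<in> pverts T\<close>.
\<close>

definition delta :: "nat \<Rightarrow> 'a pair_pre_digraph \<Rightarrow> 'a \<Rightarrow> 'a \<Rightarrow> nat \<Rightarrow> nat \<Rightarrow> nat" where
  "delta D T u v a b =
     (if \<exists>f. L21_labeling (D + 1) (add_pendant T u v) f \<and> f u = a \<and> f v = b then 1 else 0)"

definition head_compatible :: "nat \<Rightarrow> 'a pair_pre_digraph \<Rightarrow> 'a \<Rightarrow> 'a \<Rightarrow> nat \<Rightarrow> bool" where
  "head_compatible D T u v h \<longleftrightarrow>
     (\<forall>a \<in> L_set D h. \<forall>a' \<in> L_set D h. \<forall>b \<in> L_set D 0.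
        \<bar>int a - int b\<bar> \<ge> 2 \<longrightarrow> \<bar>int a' - int b\<bar> \<ge> 2 \<longrightarrow>
        delta D T u v a b = delta D T u v a' b)"

definition neck_compatible :: "nat \<Rightarrow> 'a pair_pre_digraph \<Rightarrow> 'a \<Rightarrow> 'a \<Rightarrow> nat \<Rightarrow> bool" where
  "neck_compatible D T u v h \<longleftrightarrow>
     (\<forall>a \<in> L_set D 0. \<forall>b \<in> L_set D h. \<forall>b' \<in> L_set D h.
        \<bar>int a - int b\<bar> \<ge> 2 \<longrightarrow> \<bar>int a - int b'\<bar> \<ge> 2 \<longrightarrow>
        delta D T u v a b = delta D T u v a b')"

text \<open>
  Given a family \<open>P\<close> of compatibility properties, \<open>is_level P h\<close> states that \<open>h\<close> is the level. For
  the two families above the level exists and is unique, see the lemmas at the end.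
\<close>

definition is_level :: "(nat \<Rightarrow> bool) \<Rightarrow> nat \<Rightarrow> bool" where
  "is_level P h \<longleftrightarrow> (if h = 0 then P 0 else \<not> P (h - 1) \<and> P h)"

definition head_level :: "nat \<Rightarrow> 'a pair_pre_digraph \<Rightarrow> 'a \<Rightarrow> 'a \<Rightarrow> nat" where
  "head_level D T u v = (THE h. is_level (head_compatible D T u v) h)"

definition neck_level :: "nat \<Rightarrow> 'a pair_pre_digraph \<Rightarrow> 'a \<Rightarrow> 'a \<Rightarrow> nat" where
  "neck_level D T u v = (THE h. is_level (neck_compatible D T u v) h)"

lemma ex1_is_level:
  assumes mono: "\<And>i j. i \<le> j \<Longrightarrow> P i \<Longrightarrow> P j" and ex: "P n"
  shows "\<exists>!h. is_level P h"
proof (rule ex1I)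
  have "P (LEAST h. P h)" using ex by (rule LeastI)
  moreover have "\<not> P ((LEAST h. P h) - 1)" if "(LEAST h. P h) \<noteq> 0"
    using that by (intro not_less_Least) simp
  ultimately show "is_level P (LEAST h. P h)"
    by (auto simp: is_level_def)
next
  fix h assume h: "is_level P h"
  have "P h" using h by (auto simp: is_level_def split: if_splits)
  moreover have "h \<le> k" if "P k" for k
  proof (rule ccontr)
    assume "\<not> h \<le> k"
    then have "h \<noteq> 0" "k \<le> h - 1" by auto
    with mono[OF this(2) that] h show False by (simp add: is_level_def)
  qed
  ultimately show "h = (LEAST h. P h)" by (rule Least_equality[symmetric])
qed

lemma L_set_antimono: "i \<le> j \<Longrightarrow> L_set D j \<subseteq> L_set D i"
  by (auto simp: L_set_def)

lemma L_set_empty: "L_set D (D + 2) = {}"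
  by (simp add: L_set_def)

lemma ex1_head_level: "\<exists>!h. is_level (head_compatible D T u v) h"
proof (rule ex1_is_level)
  show "head_compatible D T u v (D + 2)"
    unfolding head_compatible_def L_set_empty by simp
  show "head_compatible D T u v j" if "i \<le> j" "head_compatible D T u v i" for i j
    using that(2) L_set_antimono[OF that(1), of D] unfolding head_compatible_def by blast
qed

lemma ex1_neck_level: "\<exists>!h. is_level (neck_compatible D T u v) h"
proof (rule ex1_is_level)
  show "neck_compatible D T u v (D + 2)"
    unfolding neck_compatible_def L_set_empty by simp
  show "neck_compatible D T u v j" if "i \<le> j" "neck_compatible D T u v i" for i j
    using that(2) L_set_antimono[OF that(1), of D] unfolding neck_compatible_def by blast
qed

end

theory Submission
  imports Defs
begin

text \<open>
  Write \<open>N h\<close> for the least size of a rooted tree that is not head- and neck-compatible for \<open>L\<^sub>h\<close>.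
  The heart of the matter is \<open>N (q + 2) \<ge> (\<Delta> / 20) * N q\<close> for \<open>4 * (q + 2) \<le> \<Delta>\<close> and \<open>\<Delta> \<ge> 400\<close>.
  In a smallest tree that is not compatible for \<open>L\<^sub>q\<^sub>+\<^sub>2\<close> all proper subtrees are compatible for
  \<open>L\<^sub>q\<^sub>+\<^sub>2\<close>. If it is smaller than \<open>(\<Delta> / 20) * N q\<close>, then on each of the first three levels below
  the root fewer than \<open>\<Delta> / 20\<close> subtrees are bad, i.e. not compatible for \<open>L\<^sub>q\<close>. A kid of the root
  that is labelled \<open>c\<close> can then be relabelled with almost every value of \<open>L\<^sub>q\<^sub>+\<^sub>1\<close>: avoid the labels
  of its bad kids and of their bad kids, and repair the labels of the others, which are flexible.
  So bad kids can be moved out of the way before the root label is changed from \<open>b\<close> to \<open>b'\<close>,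
  and the at most three good kids that obstruct \<open>b'\<close> take over \<open>b - 1\<close>, \<open>b\<close>, \<open>b + 1\<close>.
  Hence \<open>N (2 * k) \<ge> (\<Delta> / 20) ^ k\<close>, which gives the logarithmic bound; small \<open>\<Delta>\<close> and large \<open>h\<close>
  are covered by the trivial bound \<open>\<Delta> + 2\<close> on the levels.
\<close>

section \<open>Compatibility of small rooted trees\<close>

definition apart :: "nat \<Rightarrow> nat \<Rightarrow> nat \<Rightarrow> bool" where
  "apart k a b \<longleftrightarrow> a + k \<le> b \<or> b + k \<le> a"

definition near :: "nat \<Rightarrow> nat \<Rightarrow> nat set" where
  "near k a = {x. \<not> apart k a x}"

lemma apart_sym: "apart k a b \<longleftrightarrow> apart k b a"
  by (auto simp: apart_def)

lemma apart_2_iff: "apart 2 a b \<longleftrightarrow> \<bar>int a - int b\<bar> \<ge> 2"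
  by (auto simp: apart_def)

lemma near_subset: "near (Suc k) a \<subseteq> {a - k..a + k}"
  by (auto simp: near_def apart_def)

lemma finite_near: "finite (near (Suc k) a)"
  using near_subset by (rule finite_subset) simp

lemma card_near: "card (near (Suc k) a) \<le> 2 * k + 1"
proof -
  have "card (near (Suc k) a) \<le> card {a - k..a + k}"
    using near_subset by (intro card_mono) auto
  then show ?thesis by simp
qed

lemmas near_2 = finite_near[of 1, simplified, folded numeral_2_eq_2]
  card_near[of 1, simplified, folded numeral_2_eq_2]

lemmas near_3 = finite_near[of 2, simplified, folded numeral_3_eq_3]
  card_near[of 2, simplified, folded numeral_3_eq_3]

text \<open>Under the first assumption \<open>L_set D q\<close> has exactly
  \<open>D + 2 - 2 * q\<close> elements. All auxiliary labels below are found by this count.\<close>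

lemma ex_L_set_avoid:
  assumes "card X + 2 * q < D + 2" "finite X"
  obtains c where "c \<in> L_set D q" "c \<notin> X"
proof -
  have "\<not> L_set D q \<subseteq> X"
  proof
    assume "L_set D q \<subseteq> X"
    then have "card (L_set D q) \<le> card X" using assms(2) by (rule card_mono[rotated])
    then show False using assms(1) by (simp add: L_set_def)
  qed
  then show ?thesis using that by blast
qed

section \<open>Rooted trees as a datatype, extendability and compatibility\<close>

datatype 'a rtree = Node (root: 'a) (kids: "'a rtree list")

text \<open>\<open>extends D t a b\<close> is \<open>\<delta>((u,v),(a,b)) = 1\<close> for \<open>t\<close> hung below a new vertex \<open>u\<close>, except
  that \<open>a \<le> D + 1\<close> is not demanded. Kids are treated as a set here and in \<open>tree_size\<close>: in the
  trees of interest all vertices, hence all kids, are distinct.\<close>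

fun extends :: "nat \<Rightarrow> 'a rtree \<Rightarrow> nat \<Rightarrow> nat \<Rightarrow> bool" where
  "extends D (Node x ts) a b \<longleftrightarrow> b \<le> D + 1 \<and> apart 2 a b \<and>
     (\<exists>c. inj_on c (set ts) \<and> (\<forall>s\<in>set ts. c s \<noteq> a \<and> extends D s b (c s)))"

fun tree_size :: "'a rtree \<Rightarrow> nat" where
  "tree_size (Node x ts) = Suc (\<Sum>s\<in>set ts. tree_size s)"

definition kid_labels :: "nat \<Rightarrow> 'a rtree \<Rightarrow> nat \<Rightarrow> nat \<Rightarrow> ('a rtree \<Rightarrow> nat) \<Rightarrow> bool" where
  "kid_labels D t a b c \<longleftrightarrow>
     inj_on c (set (kids t)) \<and> (\<forall>s\<in>set (kids t). c s \<noteq> a \<and> extends D s b (c s))"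

lemma extends_iff:
  "extends D t a b \<longleftrightarrow> b \<le> D + 1 \<and> apart 2 a b \<and> (\<exists>c. kid_labels D t a b c)"
  by (cases t) (auto simp: kid_labels_def)

lemma extendsD: "extends D t a b \<Longrightarrow> b \<le> D + 1" "extends D t a b \<Longrightarrow> apart 2 a b"
  by (auto simp: extends_iff)

lemma tree_size_eq: "tree_size t = Suc (\<Sum>s\<in>set (kids t). tree_size s)"
  by (cases t) auto

text \<open>One implication suffices, here and in \<open>neck_comp\<close>: the two labels compared
  are interchangeable, and \<open>extends D t a b\<close> already contains
  \<open>apart 2 a b\<close> and \<open>b \<le> D + 1\<close>.\<close>

definition head_comp :: "nat \<Rightarrow> nat \<Rightarrow> 'a rtree \<Rightarrow> bool" where
  "head_comp D h t \<longleftrightarrow> (\<forall>a\<in>L_set D h. \<forall>a'\<in>L_set D h. \<forall>b.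
     apart 2 a' b \<longrightarrow> extends D t a b \<longrightarrow> extends D t a' b)"

definition neck_comp :: "nat \<Rightarrow> nat \<Rightarrow> 'a rtree \<Rightarrow> bool" where
  "neck_comp D h t \<longleftrightarrow> (\<forall>a\<in>L_set D 0. \<forall>b\<in>L_set D h. \<forall>b'\<in>L_set D h.
     apart 2 a b' \<longrightarrow> extends D t a b \<longrightarrow> extends D t a b')"

definition bad_kids :: "nat \<Rightarrow> nat \<Rightarrow> 'a rtree \<Rightarrow> 'a rtree set" where
  "bad_kids D h t = {s \<in> set (kids t). \<not> (head_comp D h s \<and> neck_comp D h s)}"

lemma finite_bad_kids [simp]: "finite (bad_kids D h t)"
  by (simp add: bad_kids_def)

lemma bad_kids_subset: "bad_kids D h t \<subseteq> set (kids t)"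
  by (auto simp: bad_kids_def)

section \<open>Relabelling below a vertex\<close>

text \<open>Changing the label above the root from \<open>a\<close> to \<open>a'\<close> affects
  only a kid labelled \<open>a'\<close>. It takes over \<open>a\<close>, which no kid carries, so
  neck compatibility is asked of this kid alone.\<close>

lemma head_flexible:
  assumes c: "kid_labels D t a b c" and b: "b \<le> D + 1"
    and a: "a \<in> L_set D h" "a' \<in> L_set D h" and far: "apart 2 a b" "apart 2 a' b"
    and nb: "\<And>s. s \<in> set (kids t) \<Longrightarrow> c s = a' \<Longrightarrow> neck_comp D h s"
  shows "extends D t a' b"
proof -
  let ?c = "\<lambda>s. if c s = a' then a else c s"
  have "kid_labels D t a' b ?c"
    unfolding kid_labels_def
  proof (intro conjI ballI)
    show "inj_on ?c (set (kids t))"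
      using c by (auto simp: kid_labels_def inj_on_def)
  next
    fix s assume s: "s \<in> set (kids t)"
    with c have cs: "c s \<noteq> a" "extends D s b (c s)" by (auto simp: kid_labels_def)
    show "?c s \<noteq> a'" using cs by auto
    show "extends D s b (?c s)"
    proof (cases "c s = a'")
      case True
      with nb s have "neck_comp D h s" by blast
      moreover have "b \<in> L_set D 0" "apart 2 b a" using b far(1) by (auto simp: L_set_def apart_def)
      ultimately show ?thesis
        using cs True a unfolding neck_comp_def by auto
    qed (use cs in auto)
  qed
  with b far show ?thesis by (auto simp: extends_iff)
qed

lemma head_comp_if_kids_neck_comp:
  assumes "\<And>s. s \<in> set (kids t) \<Longrightarrow> neck_comp D h s"
  shows "head_comp D h t"
  unfolding head_comp_def
proof (intro ballI allI impI)
  fix a a' b assume *: "a \<in> L_set D h" "a' \<in> L_set D h" "apart 2 a' b" "extends D t a b"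
  then obtain c where "kid_labels D t a b c" "b \<le> D + 1" "apart 2 a b"
    by (auto simp: extends_iff)
  with * assms show "extends D t a' b" by (intro head_flexible)
qed

text \<open>Both ends of the edge above the root change, from \<open>(b, d)\<close> to
  \<open>(b', d')\<close>. The route is \<open>(b, d)\<close>, \<open>(b, m)\<close>,
  \<open>(b', m)\<close>, \<open>(b', d')\<close> for an \<open>m\<close> apart from both
  \<open>b\<close> and \<open>b'\<close>. These exclude at most 6 labels, hence the bound on
  \<open>q\<close>.\<close>

lemma good_move:
  assumes good: "head_comp D q s" "neck_comp D q s" and q: "2 * q + 4 < D"
    and ext: "extends D s b d"
    and mem: "b \<in> L_set D q" "b' \<in> L_set D q" "d \<in> L_set D q" "d' \<in> L_set D q"
    and far: "apart 2 b' d'"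
  shows "extends D s b' d'"
proof -
  have "card (near 2 b \<union> near 2 b') \<le> 6"
    using card_Un_le[of "near 2 b" "near 2 b'"] near_2(2)[of b] near_2(2)[of b'] by linarith
  then obtain m where m: "m \<in> L_set D q" "m \<notin> near 2 b \<union> near 2 b'"
    using q near_2(1) by - (rule ex_L_set_avoid[of "near 2 b \<union> near 2 b'" q D], auto)
  have "b \<in> L_set D 0" "b' \<in> L_set D 0" using mem by (auto simp: L_set_def)
  then have "extends D s b m"
    using good(2) ext mem m unfolding neck_comp_def near_def by blast
  then have "extends D s b' m"
    using good(1) mem m unfolding head_comp_def near_def by blast
  then show ?thesis
    using good(2) \<open>b' \<in> L_set D 0\<close> mem m far unfolding neck_comp_def by blast
qed

text \<open>The labels freed by moving the root label from \<open>b\<close> to \<open>b'\<close> are given to the kids whose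
  labels become forbidden.\<close>

lemma extends_shift:
  assumes c: "kid_labels D t a b c" and b': "b' \<le> D + 1" and b0: "b > 0"
    and far: "apart 2 a b" "apart 2 a b'" "apart 3 b b'"
    and keep: "\<And>s. s \<in> set (kids t) \<Longrightarrow> extends D s b (c s) \<Longrightarrow> apart 2 b' (c s) \<Longrightarrow> extends D s b' (c s)"
    and move: "\<And>s. s \<in> set (kids t) \<Longrightarrow> extends D s b (c s) \<Longrightarrow> \<not> apart 2 b' (c s) \<Longrightarrow>
      apart 2 b' (c s + b - b') \<Longrightarrow> \<not> apart 2 b (c s + b - b') \<Longrightarrow> extends D s b' (c s + b - b')"
  shows "extends D t a b'"
proof -
  \<comment> \<open>The labels within 1 of \<open>b'\<close> are translated to labels within 1 of
    \<open>b\<close>. No kid uses the latter, and \<open>a\<close> is not among them, since all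
    these are apart from \<open>b\<close>. By \<open>b > 0\<close> the subtraction is never
    truncated.\<close>
  let ?c = "\<lambda>s. if apart 2 b' (c s) then c s else c s + b - b'"
  have inj: "inj_on c (set (kids t))" and ext: "\<And>s. s \<in> set (kids t) \<Longrightarrow> extends D s b (c s)"
    and na: "\<And>s. s \<in> set (kids t) \<Longrightarrow> c s \<noteq> a"
    using c by (auto simp: kid_labels_def)
  have apart: "apart 2 b (c s)" if "s \<in> set (kids t)" for s
    using ext[OF that] by (rule extendsD)
  have "kid_labels D t a b' ?c"
    unfolding kid_labels_def
  proof (intro conjI ballI)
    show "inj_on ?c (set (kids t))"
    proof (rule inj_onI)
      fix s s' assume s: "s \<in> set (kids t)" "s' \<in> set (kids t)" "?c s = ?c s'"
      then have "c s = c s'"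
        using apart[OF s(1)] apart[OF s(2)] b0 unfolding apart_def
        by (auto split: if_splits)
      with inj s show "s = s'" by (auto simp: inj_on_def)
    qed
  next
    fix s assume s: "s \<in> set (kids t)"
    show "?c s \<noteq> a" using na[OF s] far b0 by (auto simp: apart_def)
    show "extends D s b' (?c s)"
    proof (cases "apart 2 b' (c s)")
      case True then show ?thesis using keep[OF s] ext[OF s] by simp
    next
      case False
      moreover have "apart 2 b' (c s + b - b')" "\<not> apart 2 b (c s + b - b')"
        using False far(3) b0 by (auto simp: apart_def)
      ultimately show ?thesis using move[OF s] ext[OF s] by simp
    qed
  qed
  with b' far show ?thesis by (auto simp: extends_iff)
qed

text \<open>The exceptional set \<open>X\<close> consists of the labels that would conflict with a bad kid or are used
  by a bad kid of a bad kid. The subtrees below these need no compatibility at all.\<close>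

lemma neck_flexible:
  assumes ext: "extends D t a b" and b: "b \<in> L_set D (Suc q)" and q: "2 * q + 4 < D"
  obtains X where "finite X"
    "card X \<le> 3 * card (bad_kids D q t) + (\<Sum>s\<in>bad_kids D q t. card (bad_kids D q s))"
    "\<And>c. c \<in> L_set D (Suc q) \<Longrightarrow> c \<notin> X \<Longrightarrow> apart 2 a c \<Longrightarrow> apart 3 b c \<Longrightarrow> extends D t a c"
proof -
  let ?B = "bad_kids D q"
  obtain d where d: "kid_labels D t a b d" using ext by (auto simp: extends_iff)
  have "\<forall>s\<in>?B t. extends D s b (d s)"
    using d by (auto simp: kid_labels_def bad_kids_def)
  then have "\<forall>s\<in>?B t. \<exists>e. kid_labels D s b (d s) e"
    by (simp add: extends_iff)
  then obtain e where e: "\<And>s. s \<in> ?B t \<Longrightarrow> kid_labels D s b (d s) (e s)" by metis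
  define X where "X = (\<Union>s\<in>?B t. near 2 (d s) \<union> e s ` ?B s)"
  have bq: "b \<in> L_set D q" "b > 0" using b by (auto simp: L_set_def)
  show ?thesis
  proof (rule that)
    show "finite X" using near_2(1) by (auto simp: X_def)
    have "card (near 2 (d s) \<union> e s ` ?B s) \<le> 3 + card (?B s)" for s
      using card_Un_le[of "near 2 (d s)" "e s ` ?B s"] near_2(2)[of "d s"]
        card_image_le[of "?B s" "e s"] by simp
    then have "card X \<le> (\<Sum>s\<in>?B t. 3 + card (?B s))"
      unfolding X_def by (intro order_trans[OF card_UN_le] sum_mono) auto
    then show "card X \<le> 3 * card (?B t) + (\<Sum>s\<in>?B t. card (?B s))"
      by (simp add: sum.distrib)
  next
    fix c assume c: "c \<in> L_set D (Suc q)" "c \<notin> X" "apart 2 a c" "apart 3 b c"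
    have cq: "c \<in> L_set D q" using c by (auto simp: L_set_def)
    show "extends D t a c"
    proof (rule extends_shift[OF d])
      fix s assume s: "s \<in> set (kids t)" "extends D s b (d s)" "apart 2 c (d s)"
      show "extends D s c (d s)"
      proof (cases "s \<in> ?B t")
        case True
        show ?thesis
        proof (rule head_flexible[OF e[OF True] _ bq(1) cq])
          fix r assume r: "r \<in> set (kids s)" "e s r = c"
          then have "r \<notin> ?B s" using c(2) True by (auto simp: X_def)
          with r show "neck_comp D q r" by (auto simp: bad_kids_def)
        qed (use s extendsD[OF s(2)] b in \<open>auto simp: L_set_def apart_sym\<close>)
      next
        case False
        then have "head_comp D q s" using s(1) by (simp add: bad_kids_def)
        then show ?thesis using s(2,3) bq(1) cq unfolding head_comp_def by blast
      qed
    next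
      fix s assume s: "s \<in> set (kids t)" "extends D s b (d s)" "\<not> apart 2 c (d s)"
        "apart 2 c (d s + b - c)" "\<not> apart 2 b (d s + b - c)"
      have "s \<notin> ?B t" using c(2) s(3) by (auto simp: X_def near_def apart_sym)
      \<comment> \<open>The step from \<open>Suc q\<close> to \<open>q\<close> is the margin for
        labels at distance at most 1 from \<open>c\<close> or \<open>b\<close>.\<close>
      moreover have "d s \<in> L_set D q" "d s + b - c \<in> L_set D q"
        using s(3,5) c(1) b by (auto simp: apart_def L_set_def)
      ultimately show "extends D s c (d s + b - c)"
        using s q bq cq by - (rule good_move[of D q s b "d s" c], auto simp: bad_kids_def)
    qed (use c extendsD(2)[OF ext] bq in \<open>auto simp: L_set_def\<close>)
  qed
qed

text \<open>Among the assignments of labels to the kids with root label \<open>b\<close>, one with the fewest bad kids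
  labelled next to \<open>b'\<close> has none: otherwise such a kid exchanges its label with a value \<open>x\<close> provided
  by \<open>neck_flexible\<close> and not used by a bad kid. Then the root label can be moved to \<open>b'\<close>.\<close>

lemma neck_comp_step_apart_3:
  assumes kids: "\<And>s. s \<in> set (kids t) \<Longrightarrow> head_comp D (q + 2) s"
    and m: "card (bad_kids D q t) \<le> m"
      "\<And>s. s \<in> set (kids t) \<Longrightarrow> card (bad_kids D q s) \<le> m"
      "\<And>s. s \<in> set (kids t) \<Longrightarrow> (\<Sum>r\<in>bad_kids D q s. card (bad_kids D q r)) \<le> m"
    and D: "5 * m + 2 * q + 12 < D"
    and b: "b \<in> L_set D (q + 2)" "b' \<in> L_set D (q + 2)"
    and far: "apart 2 a b'" "apart 3 b b'"
    and ext: "extends D t a b"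
  shows "extends D t a b'"
proof -
  let ?B = "bad_kids D q"
  define bad where "bad c = {s \<in> ?B t. \<not> apart 2 b' (c s)}" for c :: "'a rtree \<Rightarrow> nat"
  have "\<exists>c. kid_labels D t a b c" using ext by (auto simp: extends_iff)
  then obtain c where c: "kid_labels D t a b c"
    and min: "\<And>c'. kid_labels D t a b c' \<Longrightarrow> card (bad c) \<le> card (bad c')"
    using ex_has_least_nat[of "kid_labels D t a b" _ "\<lambda>c. card (bad c)"] by metis
  have cext: "extends D s b (c s)" "c s \<noteq> a" if "s \<in> set (kids t)" for s
    using c that by (auto simp: kid_labels_def)
  have bq: "b \<in> L_set D q" "b' \<in> L_set D q" "b > 0" using b by (auto simp: L_set_def)
  have "bad c = {}"
  proof (rule ccontr)
    assume "bad c \<noteq> {}"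
    then obtain s where s: "s \<in> ?B t" "\<not> apart 2 b' (c s)" by (auto simp: bad_def)
    then have sk: "s \<in> set (kids t)" by (auto simp: bad_kids_def)
    \<comment> \<open>A label within 1 of \<open>b'\<close> in \<open>L_set D (q + 2)\<close> is in
      \<open>L_set D (Suc q)\<close>, where \<open>neck_flexible\<close> applies: this is why one
      round costs two levels.\<close>
    have csq: "c s \<in> L_set D (Suc q)" "c s \<in> L_set D q"
      using s b by (auto simp: apart_def L_set_def)
    obtain X where X: "finite X" "card X \<le> 3 * card (?B s) + (\<Sum>r\<in>?B s. card (?B r))"
      "\<And>x. x \<in> L_set D (Suc q) \<Longrightarrow> x \<notin> X \<Longrightarrow> apart 2 b x \<Longrightarrow> apart 3 (c s) x \<Longrightarrow> extends D s b x"
      using neck_flexible[OF cext(1)[OF sk] csq(1)] D by auto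
    have cX: "card X \<le> 4 * m" using X(2) m(2,3)[OF sk] by linarith
    \<comment> \<open>The labels that \<open>s\<close> must not get: at most \<open>4 * m\<close>
      from \<open>X\<close>, \<open>3 + 3 + 5\<close> around \<open>b\<close>, \<open>b'\<close> and
      \<open>c s\<close>, and \<open>m + 1\<close> for \<open>a\<close> and the labels of bad
      kids.\<close>
    define Y where "Y = X \<union> (near 2 b \<union> near 2 b' \<union> near 3 (c s)) \<union> insert a (c ` ?B t)"
    have "card Y \<le> card X + card (near 2 b \<union> near 2 b' \<union> near 3 (c s)) + card (insert a (c ` ?B t))"
      unfolding Y_def by (meson add_le_mono card_Un_le order_refl order_trans)
    moreover have "card (near 2 b \<union> near 2 b' \<union> near 3 (c s)) \<le> 11"
      using near_2(2)[of b] near_2(2)[of b'] near_3(2)[of "c s"]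
        card_Un_le[of "near 2 b \<union> near 2 b'" "near 3 (c s)"] card_Un_le[of "near 2 b" "near 2 b'"]
      by linarith
    moreover have "card (insert a (c ` ?B t)) \<le> Suc m"
      using card_image_le[of "?B t" c] m(1) by (simp add: card_insert_if)
    ultimately have "card Y \<le> 5 * m + 12" using cX by linarith
    moreover have "finite Y" using X(1) near_2(1) near_3(1) by (simp add: Y_def)
    ultimately obtain x where x: "x \<in> L_set D (Suc q)" "x \<notin> Y"
      using D by - (rule ex_L_set_avoid[of Y "Suc q" D], auto)
    have xq: "x \<in> L_set D q" using x(1) by (auto simp: L_set_def)
    have xfar: "apart 2 b x" "apart 2 b' x" "apart 3 (c s) x" "x \<noteq> a" "x \<notin> c ` ?B t" "x \<notin> X"
      using x(2) by (auto simp: Y_def near_def)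
    \<comment> \<open>Besides \<open>s\<close>, only a kid labelled \<open>x\<close> changes its
      label. It is good, as \<open>x\<close> is not the label of a bad kid, so it can take
      \<open>c s\<close> by \<open>good_move\<close> with \<open>b\<close> kept fixed.\<close>
    define c' where "c' = transpose x (c s) \<circ> c"
    have inj: "inj_on c (set (kids t))" using c by (simp add: kid_labels_def)
    have c's: "c' s = x" by (simp add: c'_def)
    have c'_other: "c' r = (if c r = x then c s else c r)" if "r \<in> set (kids t)" "r \<noteq> s" for r
    proof -
      have "c r \<noteq> c s" using that inj sk by (auto dest: inj_onD)
      then show ?thesis by (simp add: c'_def transpose_def)
    qed
    have "kid_labels D t a b c'"
      unfolding kid_labels_def
    proof (intro conjI ballI)
      show "inj_on c' (set (kids t))"
        unfolding c'_def using inj by (intro comp_inj_on) (auto intro: inj_on_subset[OF inj_transpose])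
    next
      fix r assume r: "r \<in> set (kids t)"
      show "c' r \<noteq> a"
        using cext(2)[OF r] cext(2)[OF sk] xfar(4) c's c'_other[OF r] by (cases "r = s") auto
      show "extends D r b (c' r)"
      proof (cases "r = s")
        case True
        then show ?thesis using X(3)[OF x(1) xfar(6,1,3)] c's by simp
      next
        case rs: False
        show ?thesis
        proof (cases "c r = x")
          case True
          then have "r \<notin> ?B t" using xfar(5) by auto
          then have "extends D r b (c s)"
            using r D cext(1)[OF r] True bq xq csq extendsD(2)[OF cext(1)[OF sk]]
            by - (rule good_move[of D q r b x b], auto simp: bad_kids_def)
          then show ?thesis using c'_other[OF r rs] True by simp
        next
          case False
          then show ?thesis using c'_other[OF r rs] cext(1)[OF r] by simp
        qed
      qed
    qed
    then have min': "card (bad c) \<le> card (bad c')" by (rule min)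
    have "bad c' \<subseteq> bad c - {s}"
    proof
      fix r assume "r \<in> bad c'"
      then have r: "r \<in> ?B t" "\<not> apart 2 b' (c' r)" by (auto simp: bad_def)
      then have "r \<noteq> s" using c's xfar by auto
      moreover have "c r \<noteq> x" using r xfar by auto
      ultimately show "r \<in> bad c - {s}"
        using r c'_other[of r] bad_kids_subset[of D q t] by (auto simp: bad_def)
    qed
    moreover have "s \<in> bad c" "finite (bad c)" using s by (simp_all add: bad_def)
    ultimately have "card (bad c') < card (bad c)"
      by (intro psubset_card_mono) auto
    with min' show False by simp
  qed
  show ?thesis
  proof (rule extends_shift[OF c])
    fix s assume "s \<in> set (kids t)" "extends D s b (c s)" "apart 2 b' (c s)"
    then show "extends D s b' (c s)" using kids b unfolding head_comp_def by blast
  next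
    fix s assume s: "s \<in> set (kids t)" "extends D s b (c s)" "\<not> apart 2 b' (c s)"
      "apart 2 b' (c s + b - b')" "\<not> apart 2 b (c s + b - b')"
    have "s \<notin> ?B t" using \<open>bad c = {}\<close> s by (auto simp: bad_def)
    moreover have "c s \<in> L_set D q" "c s + b - b' \<in> L_set D q"
      using s(3,5) b by (auto simp: apart_def L_set_def)
    ultimately show "extends D s b' (c s + b - b')"
      using s D bq by - (rule good_move[of D q s b "c s" b'], auto simp: bad_kids_def)
  qed (use b far extendsD(2)[OF ext] bq in \<open>auto simp: L_set_def\<close>)
qed

text \<open>The assumption \<open>apart 3 b b'\<close> is removed by passing through a label
  \<open>x\<close> that is 3 apart from both \<open>b\<close> and \<open>b'\<close> and 2 apart from
  \<open>a\<close>. This excludes \<open>3 + 5 + 5\<close> labels.\<close>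

lemma neck_comp_step:
  assumes kids: "\<And>s. s \<in> set (kids t) \<Longrightarrow> head_comp D (q + 2) s"
    and m: "card (bad_kids D q t) \<le> m"
      "\<And>s. s \<in> set (kids t) \<Longrightarrow> card (bad_kids D q s) \<le> m"
      "\<And>s. s \<in> set (kids t) \<Longrightarrow> (\<Sum>r\<in>bad_kids D q s. card (bad_kids D q r)) \<le> m"
    and D: "5 * m + 2 * q + 15 < D"
  shows "neck_comp D (q + 2) t"
  unfolding neck_comp_def
proof (intro ballI impI)
  fix a b b' assume *: "b \<in> L_set D (q + 2)" "b' \<in> L_set D (q + 2)" "apart 2 a b'" "extends D t a b"
  have "card (near 2 a \<union> near 3 b \<union> near 3 b') \<le> 13"
    using near_2(2)[of a] near_3(2)[of b] near_3(2)[of b']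
      card_Un_le[of "near 2 a \<union> near 3 b" "near 3 b'"] card_Un_le[of "near 2 a" "near 3 b"]
    by linarith
  then obtain x where x: "x \<in> L_set D (q + 2)" "x \<notin> near 2 a \<union> near 3 b \<union> near 3 b'"
    using D near_2(1) near_3(1)
    by - (rule ex_L_set_avoid[of "near 2 a \<union> near 3 b \<union> near 3 b'" "q + 2" D], auto)
  have "extends D t a x"
    by (rule neck_comp_step_apart_3[OF kids m, of b]) (use * x D in \<open>auto simp: near_def\<close>)
  then show "extends D t a b'"
    by (rule neck_comp_step_apart_3[OF kids m, of x, rotated -1])
      (use * x D in \<open>auto simp: near_def apart_sym\<close>)
qed

section \<open>Counting bad subtrees and the induction on the level\<close>

lemma tree_size_kid_less: "s \<in> set (kids t) \<Longrightarrow> tree_size s < tree_size t"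
  unfolding tree_size_eq[of t] by (meson List.finite_set le_imp_less_Suc member_le_sum zero_le)

text \<open>The sizes of the bad kids add up to less than that of the tree. The lower bound
  \<open>M / K\<close> on each is written without division.\<close>

lemma card_bad_kids_mult_le:
  assumes "\<And>s. s \<in> bad_kids D q t \<Longrightarrow> M \<le> K * tree_size s"
  shows "card (bad_kids D q t) * M \<le> K * tree_size t"
proof -
  have "card (bad_kids D q t) * M = (\<Sum>s\<in>bad_kids D q t. M)" by simp
  also have "\<dots> \<le> (\<Sum>s\<in>bad_kids D q t. K * tree_size s)" using assms by (rule sum_mono)
  also have "\<dots> \<le> (\<Sum>s\<in>set (kids t). K * tree_size s)"
    by (rule sum_mono2) (auto simp: bad_kids_def)
  also have "\<dots> \<le> K * tree_size t" by (simp add: tree_size_eq[of t] flip: sum_distrib_left)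
  finally show ?thesis .
qed

lemma sum_card_bad_kids_mult_le:
  assumes "\<And>s r. s \<in> bad_kids D q t \<Longrightarrow> r \<in> bad_kids D q s \<Longrightarrow> M \<le> K * tree_size r"
  shows "(\<Sum>s\<in>bad_kids D q t. card (bad_kids D q s)) * M \<le> K * tree_size t"
proof -
  have "(\<Sum>s\<in>bad_kids D q t. card (bad_kids D q s)) * M
      \<le> (\<Sum>s\<in>bad_kids D q t. K * tree_size s)"
    unfolding sum_distrib_right by (intro sum_mono card_bad_kids_mult_le assms)
  also have "\<dots> \<le> (\<Sum>s\<in>set (kids t). K * tree_size s)"
    by (rule sum_mono2) (auto simp: bad_kids_def)
  also have "\<dots> \<le> K * tree_size t" by (simp add: tree_size_eq[of t] flip: sum_distrib_left)
  finally show ?thesis .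
qed

text \<open>The outer induction on \<open>k\<close> makes bad subtrees large, hence few. The inner
  induction on the size provides the compatibility of the kids for \<open>2 * k + 2\<close> that
  \<open>neck_comp_step\<close> demands. For \<open>k = 0\<close> no tree is small enough.\<close>

lemma small_tree_comp:
  assumes "400 \<le> D" "8 * k \<le> D" "tree_size t * 20 ^ k < D ^ k"
  shows "head_comp D (2 * k) t \<and> neck_comp D (2 * k) t"
  using assms(2,3)
proof (induction k arbitrary: t)
  case 0
  then show ?case by (simp add: tree_size_eq[of t])
next
  case (Suc k)
  let ?B = "bad_kids D (2 * k)"
  have bad: "D ^ k \<le> 20 ^ k * tree_size s" if "s \<in> ?B r" for r s :: "'a rtree"
    using that Suc.IH[of s] Suc.prems(1) by (force simp: bad_kids_def mult.commute)
  define m where "m = D div 20"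
  \<comment> \<open>If \<open>n\<close> subtrees of size at least \<open>(D / 20) ^ k\<close> fit
    into a tree smaller than \<open>(D / 20) ^ Suc k\<close>, then
    \<open>n < D / 20\<close>.\<close>
  have le_m: "n \<le> m" if "n * D ^ k \<le> 20 ^ k * tree_size s" "tree_size s * 20 ^ Suc k < D ^ Suc k"
    for n and s :: "'a rtree"
  proof -
    have "(20 * n) * D ^ k \<le> 20 ^ Suc k * tree_size s" using that(1) by simp
    also have "\<dots> < D * D ^ k" using that(2) by (simp add: mult.commute)
    finally have "20 * n < D" by simp
    then show ?thesis by (simp add: m_def)
  qed
  show ?case using Suc.prems(2)
  proof (induction "tree_size t" arbitrary: t rule: less_induct)
    case less
    have small: "tree_size s * 20 ^ Suc k < D ^ Suc k" if "s \<in> set (kids t)" for s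
      using tree_size_kid_less[OF that] less.prems
      by (meson less_imp_le mult_le_mono1 order_le_less_trans)
    have IH: "head_comp D (2 * k + 2) s \<and> neck_comp D (2 * k + 2) s" if "s \<in> set (kids t)" for s
      using less.hyps[OF tree_size_kid_less[OF that] small[OF that]] by simp
    have "neck_comp D (2 * k + 2) t"
    proof (rule neck_comp_step)
      show "card (?B t) \<le> m" by (rule le_m[OF card_bad_kids_mult_le[OF bad] less.prems])
      show "card (?B s) \<le> m" if "s \<in> set (kids t)" for s
        by (rule le_m[OF card_bad_kids_mult_le[OF bad] small[OF that]])
      show "(\<Sum>r\<in>?B s. card (?B r)) \<le> m" if "s \<in> set (kids t)" for s
        by (rule le_m[OF sum_card_bad_kids_mult_le[OF bad] small[OF that]])
      \<comment> \<open>Here \<open>5 * m \<le> D / 4\<close>, and \<open>8 * Suc k \<le> D\<close>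
        gives \<open>4 * k \<le> D / 2 - 4\<close>; the remaining quarter of \<open>D\<close>
        absorbs the constant.\<close>
      show "5 * m + 2 * (2 * k) + 15 < D"
        using Suc.prems(1) assms(1) by (simp add: m_def)
    qed (use IH in auto)
    moreover have "head_comp D (2 * k + 2) t"
      using IH by (intro head_comp_if_kids_neck_comp) auto
    ultimately show ?case by simp
  qed
qed

section \<open>Labelings of tree graphs\<close>

fun nodes :: "'a rtree \<Rightarrow> 'a set" where
  "nodes (Node x ts) = insert x (\<Union>s\<in>set ts. nodes s)"

fun parent_rel :: "'a rtree \<Rightarrow> 'a rel" where
  "parent_rel (Node x ts) = Pair x ` root ` set ts \<union> (\<Union>s\<in>set ts. parent_rel s)"

fun distinct_nodes :: "'a rtree \<Rightarrow> bool" where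
  "distinct_nodes (Node x ts) \<longleftrightarrow> x \<notin> (\<Union>s\<in>set ts. nodes s) \<and>
     (\<forall>s\<in>set ts. distinct_nodes s \<and> (\<forall>s'\<in>set ts. s \<noteq> s' \<longrightarrow> nodes s \<inter> nodes s' = {}))"

text \<open>Enlarges a tree by one edge; this is what contradicts maximality in
  \<open>exists_tree_graph\<close>.\<close>

fun insert_leaf :: "'a \<Rightarrow> 'a \<Rightarrow> 'a rtree \<Rightarrow> 'a rtree" where
  "insert_leaf x y (Node r ts) =
     (if r = x then Node r (Node y [] # ts) else Node r (map (insert_leaf x y) ts))"

lemma root_in_nodes [simp]: "root t \<in> nodes t"
  by (cases t) auto

lemma finite_nodes [simp]: "finite (nodes t)"
  by (induction t) auto

lemma parent_rel_nodes: "(x, y) \<in> parent_rel t \<Longrightarrow> x \<in> nodes t \<and> y \<in> nodes t"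
proof (induction t)
  case (Node r ts)
  then show ?case using root_in_nodes by fastforce
qed

lemma card_nodes: "distinct_nodes t \<Longrightarrow> card (nodes t) = tree_size t"
proof (induction t)
  case (Node x ts)
  have "card (nodes (Node x ts)) = Suc (card (\<Union>s\<in>set ts. nodes s))"
    using Node.prems by (auto simp: card_insert_if)
  also have "card (\<Union>s\<in>set ts. nodes s) = (\<Sum>s\<in>set ts. card (nodes s))"
    using Node.prems by (intro card_UN_disjoint) auto
  also have "\<dots> = (\<Sum>s\<in>set ts. tree_size s)"
    using Node by (intro sum.cong) auto
  finally show ?case by simp
qed

lemma root_insert_leaf [simp]: "root (insert_leaf x y t) = root t"
  by (cases t) auto

lemma nodes_insert_leaf:
  "nodes (insert_leaf x y t) = (if x \<in> nodes t then insert y (nodes t) else nodes t)"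
proof (induction t)
  case (Node r ts)
  show ?case
  proof (cases "r = x")
    case False
    then have "nodes (insert_leaf x y (Node r ts)) =
        insert r (\<Union>s\<in>set ts. if x \<in> nodes s then insert y (nodes s) else nodes s)"
      using Node by simp
    with False show ?thesis by auto
  qed auto
qed

lemma parent_rel_insert_leaf:
  "parent_rel (insert_leaf x y t) =
    (if x \<in> nodes t then insert (x, y) (parent_rel t) else parent_rel t)"
proof (induction t)
  case (Node r ts)
  show ?case
  proof (cases "r = x")
    case False
    then have "parent_rel (insert_leaf x y (Node r ts)) = Pair r ` root ` set ts \<union>
        (\<Union>s\<in>set ts. if x \<in> nodes s then insert (x, y) (parent_rel s) else parent_rel s)"
      using Node by (simp add: image_image)
    with False show ?thesis by auto
  qed auto
qed

lemma distinct_nodes_insert_leaf: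
  "distinct_nodes t \<Longrightarrow> y \<notin> nodes t \<Longrightarrow> distinct_nodes (insert_leaf x y t)"
proof (induction t)
  case (Node r ts)
  show ?case
  proof (cases "r = x")
    case False
    have "nodes (insert_leaf x y s) \<inter> nodes (insert_leaf x y s') = {}"
      if "s \<in> set ts" "s' \<in> set ts" "s \<noteq> s'" for s s'
    proof -
      have "nodes s \<inter> nodes s' = {}" "y \<notin> nodes s" "y \<notin> nodes s'"
        using Node.prems that by auto
      then show ?thesis by (auto simp: nodes_insert_leaf)
    qed
    moreover have "r \<notin> nodes (insert_leaf x y s)" if "s \<in> set ts" for s
      using Node.prems that by (auto simp: nodes_insert_leaf)
    ultimately show ?thesis using False Node by auto
  qed (use Node.prems in auto)
qed

lemma root_no_parent: "distinct_nodes t \<Longrightarrow> (x, root t) \<notin> parent_rel t"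
  by (cases t) (use parent_rel_nodes root_in_nodes in fastforce)

text \<open>Disjointness puts \<open>z\<close> below a single kid \<open>s\<close>. Either
  \<open>z\<close> is the root of \<open>s\<close>, which has no parent inside \<open>s\<close>, or
  the induction hypothesis for \<open>s\<close> applies.\<close>

lemma parent_unique:
  "distinct_nodes t \<Longrightarrow> (x, z) \<in> parent_rel t \<Longrightarrow> (y, z) \<in> parent_rel t \<Longrightarrow> x = y"
proof (induction t)
  case (Node r ts)
  have child: "\<exists>s\<in>set ts. z \<in> nodes s \<and> (w = r \<and> z = root s \<or> (w, z) \<in> parent_rel s)"
    if w: "(w, z) \<in> parent_rel (Node r ts)" for w
  proof -
    from w obtain s where "s \<in> set ts" "w = r \<and> z = root s \<or> (w, z) \<in> parent_rel s" by auto
    moreover from this have "z \<in> nodes s" using parent_rel_nodes[of w z s] by auto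
    ultimately show ?thesis by blast
  qed
  obtain s where s: "s \<in> set ts" "z \<in> nodes s" "x = r \<and> z = root s \<or> (x, z) \<in> parent_rel s"
    using child[OF Node.prems(2)] by blast
  obtain s' where s': "s' \<in> set ts" "z \<in> nodes s'" "y = r \<and> z = root s' \<or> (y, z) \<in> parent_rel s'"
    using child[OF Node.prems(3)] by blast
  have "s = s'" using s s' Node.prems(1) by auto
  moreover have "distinct_nodes s" using Node.prems(1) s by auto
  ultimately show ?case using s s' Node.IH[OF s(1)] root_no_parent[of s] by blast
qed

lemma parent_rel_asym: "distinct_nodes t \<Longrightarrow> (x, y) \<in> parent_rel t \<Longrightarrow> (y, x) \<notin> parent_rel t"
proof (induction t)
  case (Node r ts)
  have xr: "x \<noteq> r" if "(y, x) \<in> parent_rel (Node r ts)"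
    using root_no_parent[OF Node.prems(1), of y] that by auto
  show ?case
  proof
    assume yx: "(y, x) \<in> parent_rel (Node r ts)"
    with xr Node.prems(2) obtain s where s: "s \<in> set ts" "(x, y) \<in> parent_rel s" by auto
    have "y \<noteq> r" using root_no_parent[OF Node.prems(1), of x] Node.prems(2) by auto
    with yx obtain s' where s': "s' \<in> set ts" "(y, x) \<in> parent_rel s'" by auto
    have "s = s'"
      using s s' parent_rel_nodes[OF s(2)] parent_rel_nodes[OF s'(2)] Node.prems(1) by auto
    then show False using s s' Node.IH[OF s(1)] Node.prems(1) by auto
  qed
qed

lemma root_reaches_nodes: "z \<in> nodes t \<Longrightarrow> (root t, z) \<in> (parent_rel t)\<^sup>*"
proof (induction t)
  case (Node r ts)
  show ?case
  proof (cases "z = r")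
    case False
    then obtain s where s: "s \<in> set ts" "z \<in> nodes s" using Node.prems by auto
    have "parent_rel s \<subseteq> parent_rel (Node r ts)" using s by auto
    then have "(root s, z) \<in> (parent_rel (Node r ts))\<^sup>*"
      using Node.IH[OF s] rtrancl_mono by blast
    moreover have "(r, root s) \<in> parent_rel (Node r ts)" using s by auto
    ultimately show ?thesis by (auto intro: converse_rtrancl_into_rtrancl)
  qed auto
qed

section \<open>Extendability in terms of vertex labelings\<close>

text \<open>Follows the recursion of \<open>extends\<close>, with one labeling of all vertices in
  place of nested choices; \<open>a\<close> is the label above the root.\<close>

fun labels :: "nat \<Rightarrow> ('a \<Rightarrow> nat) \<Rightarrow> nat \<Rightarrow> 'a rtree \<Rightarrow> bool" where
  "labels D f a (Node x ts) \<longleftrightarrow> f x \<le> D + 1 \<and> apart 2 a (f x) \<and>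
     inj_on (\<lambda>s. f (root s)) (set ts) \<and> (\<forall>s\<in>set ts. f (root s) \<noteq> a \<and> labels D f (f x) s)"

lemma labels_cong: "(\<And>x. x \<in> nodes t \<Longrightarrow> f x = g x) \<Longrightarrow> labels D f a t \<longleftrightarrow> labels D g a t"
proof (induction t arbitrary: a)
  case (Node x ts)
  have x: "f x = g x" using Node.prems by auto
  have r: "f (root s) = g (root s)" if "s \<in> set ts" for s
  proof (rule Node.prems)
    show "root s \<in> nodes (Node x ts)" using that root_in_nodes[of s] unfolding nodes.simps by blast
  qed
  have "labels D f b s \<longleftrightarrow> labels D g b s" if "s \<in> set ts" for s b
    using Node.IH[OF that] Node.prems that by auto
  moreover have "inj_on (\<lambda>s. f (root s)) (set ts) \<longleftrightarrow> inj_on (\<lambda>s. g (root s)) (set ts)"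
    using r by (rule inj_on_cong)
  ultimately show ?case using x r by auto
qed

lemma extends_iff_labels:
  "distinct_nodes t \<Longrightarrow> extends D t a b \<longleftrightarrow> (\<exists>f. labels D f a t \<and> f (root t) = b)"
proof (induction t arbitrary: a b)
  case (Node x ts)
  have IH: "extends D s a b \<longleftrightarrow> (\<exists>f. labels D f a s \<and> f (root s) = b)" if "s \<in> set ts" for s a b
    using Node.IH[OF that] Node.prems that by auto
  show ?case
  proof
    assume "extends D (Node x ts) a b"
    then obtain c where c: "b \<le> D + 1" "apart 2 a b" "inj_on c (set ts)"
      "\<And>s. s \<in> set ts \<Longrightarrow> c s \<noteq> a" "\<And>s. s \<in> set ts \<Longrightarrow> extends D s b (c s)" by auto
    have "\<forall>s\<in>set ts. \<exists>f. labels D f b s \<and> f (root s) = c s"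
      using c(5) IH by blast
    then obtain g where g: "\<And>s. s \<in> set ts \<Longrightarrow> labels D (g s) b s"
      "\<And>s. s \<in> set ts \<Longrightarrow> g s (root s) = c s" by metis
    \<comment> \<open>The labelings of the kids are glued: \<open>THE\<close> picks the only kid
      that contains \<open>y\<close>.\<close>
    define f where "f y = (if y = x then b else g (THE s. s \<in> set ts \<and> y \<in> nodes s) y)" for y
    have fx: "f x = b" by (simp add: f_def)
    have fs: "f y = g s y" if "s \<in> set ts" "y \<in> nodes s" for s y
    proof -
      have "(THE s. s \<in> set ts \<and> y \<in> nodes s) = s"
        using that Node.prems by (intro the_equality) auto
      moreover have "y \<noteq> x" using that Node.prems by auto
      ultimately show ?thesis by (simp add: f_def)
    qed
    have "labels D f b s" if "s \<in> set ts" for s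
      using g(1)[OF that] fs[OF that] labels_cong[of s f "g s"] by blast
    moreover have fr: "f (root s) = c s" if "s \<in> set ts" for s
      using fs[OF that] g(2)[OF that] by simp
    moreover have "inj_on (\<lambda>s. f (root s)) (set ts)"
      using c(3) fr by (simp cong: inj_on_cong)
    ultimately have "labels D f a (Node x ts)"
      using c fx by simp
    with fx show "\<exists>f. labels D f a (Node x ts) \<and> f (root (Node x ts)) = b" by auto
  next
    assume "\<exists>f. labels D f a (Node x ts) \<and> f (root (Node x ts)) = b"
    then obtain f where f: "labels D f a (Node x ts)" "f x = b" by auto
    then have "\<forall>s\<in>set ts. extends D s b (f (root s))" using IH by auto
    with f show "extends D (Node x ts) a b" by auto
  qed
qed

text \<open>The conditions of an \<open>L(2,1)\<close>-labeling for a parent relation: vertices at distance two are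
  siblings or grandparent and grandchild.\<close>

definition separates :: "('a \<Rightarrow> nat) \<Rightarrow> 'a rel \<Rightarrow> bool" where
  "separates f E \<longleftrightarrow> (\<forall>x y. (x, y) \<in> E \<longrightarrow> apart 2 (f x) (f y)) \<and>
     (\<forall>x y z. (x, y) \<in> E \<longrightarrow> (x, z) \<in> E \<longrightarrow> y \<noteq> z \<longrightarrow> f y \<noteq> f z) \<and>
     (\<forall>x y z. (x, y) \<in> E \<longrightarrow> (y, z) \<in> E \<longrightarrow> f x \<noteq> f z)"

lemma separatesD:
  assumes "separates f E"
  shows "(x, y) \<in> E \<Longrightarrow> apart 2 (f x) (f y)"
    and "(x, y) \<in> E \<Longrightarrow> (x, z) \<in> E \<Longrightarrow> y \<noteq> z \<Longrightarrow> f y \<noteq> f z"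
    and "(x, y) \<in> E \<Longrightarrow> (y, z) \<in> E \<Longrightarrow> f x \<noteq> f z"
  using assms unfolding separates_def by blast+

lemma separates_subset: "separates f E \<Longrightarrow> E' \<subseteq> E \<Longrightarrow> separates f E'"
  unfolding separates_def by blast

text \<open>Every condition of \<open>separates\<close> involves at most two edges. Either both lie
  in one \<open>E s\<close>, which the induction hypothesis covers with \<open>x\<close> as the new
  vertex above \<open>s\<close>, or they meet at \<open>x\<close>, which \<open>labels\<close>
  checks directly.\<close>

lemma labels_iff_separates:
  "distinct_nodes t \<Longrightarrow> u \<notin> nodes t \<Longrightarrow>
    labels D f (f u) t \<longleftrightarrow> (\<forall>x\<in>nodes t. f x \<le> D + 1) \<and> separates f (parent_rel (Node u [t]))"
proof (induction t arbitrary: u)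
  case (Node x ts)
  define E where "E s = insert (x, root s) (parent_rel s)" for s
  have E_src: "p = x \<and> y = root s \<or> p \<in> nodes s" and E_tgt: "y \<in> nodes s" if "(p, y) \<in> E s" for p y s
    using that parent_rel_nodes[of p y s] by (auto simp: E_def)
  have EE: "parent_rel (Node u [Node x ts]) = insert (u, x) (\<Union>s\<in>set ts. E s)"
    by (auto simp: E_def)
  have x: "x \<notin> nodes s" and u: "u \<notin> nodes s" "u \<noteq> x" if "s \<in> set ts" for s
    using Node.prems that by auto
  have ux: "u \<noteq> x" using Node.prems by auto
  have disj: "s = s'" if "s \<in> set ts" "s' \<in> set ts" "y \<in> nodes s" "y \<in> nodes s'" for s s' y
    using Node.prems that by auto
  have IH: "labels D f (f x) s \<longleftrightarrow> (\<forall>y\<in>nodes s. f y \<le> D + 1) \<and> separates f (E s)"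
    if "s \<in> set ts" for s
    using Node.IH[OF that] Node.prems that by (auto simp: E_def)
  show ?case
  proof
    assume L: "labels D f (f u) (Node x ts)"
    then have fx: "f x \<le> D + 1" "apart 2 (f u) (f x)"
      and inj: "inj_on (\<lambda>s. f (root s)) (set ts)"
      and fr: "\<And>s. s \<in> set ts \<Longrightarrow> f (root s) \<noteq> f u"
      and le: "\<And>s y. s \<in> set ts \<Longrightarrow> y \<in> nodes s \<Longrightarrow> f y \<le> D + 1"
      and sep: "\<And>s. s \<in> set ts \<Longrightarrow> separates f (E s)"
      using IH by auto
    have "separates f (insert (u, x) (\<Union>s\<in>set ts. E s))"
      unfolding separates_def
    proof (intro conjI allI impI)
      fix p y assume "(p, y) \<in> insert (u, x) (\<Union>s\<in>set ts. E s)"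
      then show "apart 2 (f p) (f y)" using fx sep by (auto simp: separates_def)
    next
      fix p y z
      assume py: "(p, y) \<in> insert (u, x) (\<Union>s\<in>set ts. E s)"
        and pz: "(p, z) \<in> insert (u, x) (\<Union>s\<in>set ts. E s)" and yz: "y \<noteq> z"
      have pu: "p \<noteq> u"
      proof
        assume "p = u"
        then have "(p, w) \<notin> E s" if "s \<in> set ts" for s w using E_src[of p w s] u[OF that] by auto
        with py pz yz show False by auto
      qed
      then obtain s s' where s: "s \<in> set ts" "(p, y) \<in> E s" and s': "s' \<in> set ts" "(p, z) \<in> E s'"
        using py pz by auto
      show "f y \<noteq> f z"
      proof (cases "s = s'")
        case True
        then show ?thesis using separatesD(2)[OF sep[OF s(1)] s(2) _ yz] s'(2) by simp
      next
        case False
        then have "p = x" "y = root s" "z = root s'"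
          using E_src[OF s(2)] E_src[OF s'(2)] disj[OF s(1) s'(1)] x[OF s(1)] x[OF s'(1)] by auto
        then show ?thesis using inj False s s' by (auto simp: inj_on_def)
      qed
    next
      fix p y z
      assume py: "(p, y) \<in> insert (u, x) (\<Union>s\<in>set ts. E s)"
        and yz: "(y, z) \<in> insert (u, x) (\<Union>s\<in>set ts. E s)"
      have "y \<noteq> u"
      proof
        assume "y = u"
        then have "(p, y) \<notin> E s" if "s \<in> set ts" for s using E_tgt[of p y s] u(1)[OF that] by auto
        with py \<open>y = u\<close> ux show False by auto
      qed
      then obtain s where s: "s \<in> set ts" "(y, z) \<in> E s" using yz by auto
      show "f p \<noteq> f z"
      proof (cases "(p, y) = (u, x)")
        case True
        then show ?thesis using E_src[OF s(2)] x[OF s(1)] fr[OF s(1)] by auto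
      next
        case False
        then obtain s' where s': "s' \<in> set ts" "(p, y) \<in> E s'" using py by auto
        then have "s = s'"
          using E_src[OF s(2)] E_tgt[OF s'(2)] x[OF s'(1)] disj[OF s(1) s'(1)] by auto
        then show ?thesis using separatesD(3)[OF sep[OF s(1)] _ s(2)] s'(2) by simp
      qed
    qed
    then show "(\<forall>x\<in>nodes (Node x ts). f x \<le> D + 1) \<and> separates f (parent_rel (Node u [Node x ts]))"
      using fx le unfolding EE by auto
  next
    assume R: "(\<forall>x\<in>nodes (Node x ts). f x \<le> D + 1) \<and> separates f (parent_rel (Node u [Node x ts]))"
    then have sep: "separates f (insert (u, x) (\<Union>s\<in>set ts. E s))"
      and le: "f x \<le> D + 1" "\<And>s y. s \<in> set ts \<Longrightarrow> y \<in> nodes s \<Longrightarrow> f y \<le> D + 1"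
      unfolding EE by auto
    have Er: "(x, root s) \<in> insert (u, x) (\<Union>s\<in>set ts. E s)" if "s \<in> set ts" for s
      using that by (auto simp: E_def)
    have ux_in: "(u, x) \<in> insert (u, x) (\<Union>s\<in>set ts. E s)" by simp
    have "labels D f (f x) s" if "s \<in> set ts" for s
      using IH[OF that] le(2)[OF that] separates_subset[OF sep, of "E s"] that by blast
    moreover have "f (root s) \<noteq> f u" if "s \<in> set ts" for s
      using separatesD(3)[OF sep ux_in Er[OF that]] by simp
    moreover have "inj_on (\<lambda>s. f (root s)) (set ts)"
    proof (rule inj_onI)
      fix s s' assume s: "s \<in> set ts" "s' \<in> set ts" "f (root s) = f (root s')"
      then have "root s = root s'" using separatesD(2)[OF sep Er[OF s(1)] Er[OF s(2)]] by auto
      then show "s = s'" using disj[OF s(1,2) root_in_nodes] root_in_nodes[of s'] by simp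
    qed
    moreover have "apart 2 (f u) (f x)" using separatesD(1)[OF sep ux_in] .
    ultimately show "labels D f (f u) (Node x ts)" using le by simp
  qed
qed

section \<open>Distance two and labelings of graphs\<close>

lemma (in pair_wf_digraph) graph_dist_eq_2_iff:
  assumes "x \<in> pverts G"
  shows "graph_dist G x y = 2 \<longleftrightarrow>
    x \<noteq> y \<and> (x, y) \<notin> parcs G \<and> (\<exists>z. (x, z) \<in> parcs G \<and> (z, y) \<in> parcs G)"
proof -
  have cost: "awalk_cost (\<lambda>_. 1) p = real (length p)" for p :: "('a \<times> 'a) list"
    by (induction p) auto
  have dist: "graph_dist G x y = (INF p\<in>{p. awalk x p y}. ereal (real (length p)))"
    unfolding graph_dist_def \<mu>_def cost ..
  have le: "graph_dist G x y \<le> ereal (real (length p))" if "awalk x p y" for p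
    unfolding dist using that by (auto intro: INF_lower)
  show ?thesis
  proof
    assume 2: "graph_dist G x y = 2"
    have min: "2 \<le> length p" if "awalk x p y" for p
      using le[OF that] 2 by (metis ereal_less_eq(3) numeral_eq_ereal of_nat_le_iff of_nat_numeral)
    have "x \<noteq> y" using min[of "[]"] assms by (auto simp: awalk_Nil_iff)
    \<comment> \<open>An edge would be a walk of length 1. Since the infimum is below 3, some walk
      has length below 3, and by \<open>min\<close> its length is exactly 2.\<close>
    moreover have "(x, y) \<notin> parcs G"
      using min[of "[(x, y)]"] by (auto simp: awalk_simps dest: in_arcsD2)
    moreover have "graph_dist G x y < 3" unfolding 2 by simp
    then obtain p where p: "awalk x p y" "length p < 3"
      unfolding dist INF_less_iff by (auto simp: numeral_eq_ereal)
    then have "length p = 2" using min by fastforce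
    then obtain e e' where "p = [e, e']" by (auto simp: numeral_2_eq_2 length_Suc_conv)
    then have "\<exists>z. (x, z) \<in> parcs G \<and> (z, y) \<in> parcs G"
      using p(1) by (cases e, cases e') (auto simp: awalk_simps)
    ultimately show "x \<noteq> y \<and> (x, y) \<notin> parcs G \<and> (\<exists>z. (x, z) \<in> parcs G \<and> (z, y) \<in> parcs G)" by blast
  next
    assume R: "x \<noteq> y \<and> (x, y) \<notin> parcs G \<and> (\<exists>z. (x, z) \<in> parcs G \<and> (z, y) \<in> parcs G)"
    then obtain z where "(x, z) \<in> parcs G" "(z, y) \<in> parcs G" by blast
    then have "awalk x [(x, z), (z, y)] y" by (auto simp: awalk_simps dest: in_arcsD2)
    from le[OF this] have "graph_dist G x y \<le> 2" by (simp add: numeral_eq_ereal)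
    moreover have "2 \<le> length p" if "awalk x p y" for p
    proof (cases p)
      case Nil
      then show ?thesis using that R by (auto simp: awalk_Nil_iff)
    next
      case (Cons e p')
      then have "p' \<noteq> []" using that R by (cases e) (auto simp: awalk_simps)
      then show ?thesis using Cons by (cases p') auto
    qed
    then have "2 \<le> graph_dist G x y"
      unfolding dist by (intro INF_greatest) (auto simp: numeral_eq_ereal)
    ultimately show "graph_dist G x y = 2" by simp
  qed
qed

text \<open>The condition at distance 2 may be imposed on the ends of every walk
  \<open>x, z, y\<close> with \<open>x \<noteq> y\<close>: if \<open>x\<close> and \<open>y\<close>
  are adjacent, their labels differ anyway.\<close>

lemma (in pair_wf_digraph) L21_labeling_iff:
  "L21_labeling k G f \<longleftrightarrow> (\<forall>x\<in>pverts G. f x \<le> k) \<and>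
     (\<forall>x y. (x, y) \<in> parcs G \<longrightarrow> apart 2 (f x) (f y)) \<and>
     (\<forall>x y z. (x, z) \<in> parcs G \<longrightarrow> (z, y) \<in> parcs G \<longrightarrow> x \<noteq> y \<longrightarrow> f x \<noteq> f y)"
proof -
  have ne: "\<bar>int m - int n\<bar> \<ge> 1 \<longleftrightarrow> m \<noteq> n" and range: "m \<in> {0..n} \<longleftrightarrow> m \<le> n" for m n :: nat
    by auto
  have "f x \<noteq> f y" if "apart 2 (f x) (f y)" for x y using that by (auto simp: apart_def)
  then have ap: "(x, y) \<in> parcs G \<longrightarrow> f x \<noteq> f y" if "\<forall>x\<in>pverts G. \<forall>y\<in>pverts G. (x, y) \<in> parcs G \<longrightarrow> apart 2 (f x) (f y)"
    for x y using that in_arcsD1 in_arcsD2 by blast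
  show ?thesis
    unfolding L21_labeling_def ne range apart_2_iff[symmetric]
  proof (intro iffI conjI allI ballI impI; elim conjE)
    fix x y z
    assume "\<forall>x\<in>pverts G. \<forall>y\<in>pverts G. (x, y) \<in> parcs G \<longrightarrow> apart 2 (f x) (f y)"
      and 2: "\<forall>x\<in>pverts G. \<forall>y\<in>pverts G. graph_dist G x y = 2 \<longrightarrow> f x \<noteq> f y"
      and xzy: "(x, z) \<in> parcs G" "(z, y) \<in> parcs G" "x \<noteq> y"
    then show "f x \<noteq> f y"
      using ap[of x y] in_arcsD1[OF xzy(1)] in_arcsD2[OF xzy(2)] graph_dist_eq_2_iff[of x y] by blast
  next
    fix x y
    assume "\<forall>x y z. (x, z) \<in> parcs G \<longrightarrow> (z, y) \<in> parcs G \<longrightarrow> x \<noteq> y \<longrightarrow> f x \<noteq> f y"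
      "x \<in> pverts G" "graph_dist G x y = 2"
    then show "f x \<noteq> f y" using graph_dist_eq_2_iff[of x y] by blast
  qed (use in_arcsD1 in_arcsD2 in blast)+
qed

section \<open>From the datatype to graphs and back\<close>

definition tree_graph :: "'a rtree \<Rightarrow> 'a pair_pre_digraph" where
  "tree_graph t = \<lparr> pverts = nodes t, parcs = parent_rel t \<union> (parent_rel t)\<inverse> \<rparr>"

lemma pair_wf_digraph_tree_graph: "pair_wf_digraph (tree_graph t)"
  by unfold_locales (auto simp: tree_graph_def dest: parent_rel_nodes)

text \<open>Two steps in the graph go up and down, down twice or up twice; down and then up returns
  to the start because parents are unique.\<close>

lemma L21_labeling_tree_graph_iff:
  assumes "distinct_nodes t"
  shows "L21_labeling k (tree_graph t) f \<longleftrightarrow> (\<forall>x\<in>nodes t. f x \<le> k) \<and> separates f (parent_rel t)"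
proof -
  interpret pair_wf_digraph "tree_graph t" by (rule pair_wf_digraph_tree_graph)
  have un: "x = y" if "(x, z) \<in> parent_rel t" "(y, z) \<in> parent_rel t" for x y z
    using parent_unique[OF assms that] .
  have nc: "x \<noteq> z" if "(x, y) \<in> parent_rel t" "(y, z) \<in> parent_rel t" for x y z
    using parent_rel_asym[OF assms that(1)] that(2) by auto
  have V: "pverts (tree_graph t) = nodes t"
    and A: "(x, y) \<in> parcs (tree_graph t) \<longleftrightarrow> (x, y) \<in> parent_rel t \<or> (y, x) \<in> parent_rel t" for x y
    by (auto simp: tree_graph_def)
  show ?thesis
    unfolding L21_labeling_iff separates_def V A
  proof (intro iffI conjI allI impI; elim conjE)
    fix x y assume "\<forall>x y. (x, y) \<in> parent_rel t \<longrightarrow> apart 2 (f x) (f y)"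
      "(x, y) \<in> parent_rel t \<or> (y, x) \<in> parent_rel t"
    then show "apart 2 (f x) (f y)" using apart_sym by blast
  next
    fix x y z assume "\<forall>x y z. (x, z) \<in> parent_rel t \<or> (z, x) \<in> parent_rel t \<longrightarrow>
        (z, y) \<in> parent_rel t \<or> (y, z) \<in> parent_rel t \<longrightarrow> x \<noteq> y \<longrightarrow> f x \<noteq> f y"
      "(x, y) \<in> parent_rel t" "(y, z) \<in> parent_rel t"
    then show "f x \<noteq> f z" using nc by blast
  next
    fix x y z
    assume sib: "\<forall>x y z. (x, y) \<in> parent_rel t \<longrightarrow> (x, z) \<in> parent_rel t \<longrightarrow> y \<noteq> z \<longrightarrow> f y \<noteq> f z"
      and chain: "\<forall>x y z. (x, y) \<in> parent_rel t \<longrightarrow> (y, z) \<in> parent_rel t \<longrightarrow> f x \<noteq> f z"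
      and *: "(x, z) \<in> parent_rel t \<or> (z, x) \<in> parent_rel t"
        "(z, y) \<in> parent_rel t \<or> (y, z) \<in> parent_rel t" "x \<noteq> y"
    from *(1,2) show "f x \<noteq> f y"
    proof (elim disjE)
      assume "(x, z) \<in> parent_rel t" "(y, z) \<in> parent_rel t"
      then show ?thesis using un *(3) by blast
    qed (use sib chain *(3) in metis)+
  qed blast+
qed

lemma add_pendant_tree_graph:
  "add_pendant (tree_graph t) u (root t) = tree_graph (Node u [t])"
  by (auto simp: add_pendant_def tree_graph_def)

lemma delta_tree_graph:
  assumes "distinct_nodes t" "u \<notin> nodes t"
  shows "delta D (tree_graph t) u (root t) a b = (if a \<le> D + 1 \<and> extends D t a b then 1 else 0)"
proof -
  have L21: "L21_labeling (D + 1) (add_pendant (tree_graph t) u (root t)) f \<longleftrightarrow>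
      f u \<le> D + 1 \<and> labels D f (f u) t" for f
    using assms labels_iff_separates[OF assms, of D f]
    by (simp add: add_pendant_tree_graph L21_labeling_tree_graph_iff del: parent_rel.simps)
  have "(\<exists>f. L21_labeling (D + 1) (add_pendant (tree_graph t) u (root t)) f \<and> f u = a \<and> f (root t) = b)
      \<longleftrightarrow> a \<le> D + 1 \<and> extends D t a b"
    unfolding L21 extends_iff_labels[OF assms(1)]
  proof safe
    fix f assume f: "a \<le> D + 1" "labels D f a t" "b = f (root t)"
    \<comment> \<open>\<open>labels D f a t\<close> does not constrain \<open>f u\<close>, so the
      value at \<open>u\<close> can be set to \<open>a\<close>.\<close>
    let ?f = "f(u := a)"
    have "labels D f a t \<longleftrightarrow> labels D ?f a t"
      by (rule labels_cong) (use assms(2) in auto)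
    with f(2) have "labels D ?f a t" by simp
    moreover have "root t \<noteq> u" using assms(2) root_in_nodes[of t] by auto
    ultimately show "\<exists>g. (g u \<le> D + 1 \<and> labels D g (g u) t) \<and> g u = a \<and> g (root t) = f (root t)"
      using f by (intro exI[of _ ?f]) auto
  qed auto
  then show ?thesis by (simp add: delta_def)
qed

text \<open>A largest rooted tree inside \<open>T\<close> spans \<open>T\<close> by connectedness, and a further edge of \<open>T\<close>
  would close a cycle.\<close>

lemma exists_tree_graph:
  assumes "rooted_tree T v"
  obtains t where "distinct_nodes t" "root t = v" "T = tree_graph t"
proof -
  from assms have "pair_graph T" and conn: "connected (with_proj T)" and v: "v \<in> pverts T"
    and no_cycle: "\<nexists>p. pre_digraph.cycle (with_proj T) p \<and> 3 \<le> length p"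
    by (auto simp: rooted_tree_def undirected_tree_def)
  interpret T: pair_graph T by fact
  define P where "P t \<longleftrightarrow> distinct_nodes t \<and> root t = v \<and> nodes t \<subseteq> pverts T \<and> parent_rel t \<subseteq> parcs T"
    for t
  have "P (Node v [])" using v by (simp add: P_def)
  moreover have "card (nodes t) < Suc (card (pverts T))" if "P t" for t
    using that T.pair_finite_verts by (auto simp: P_def less_Suc_eq_le intro: card_mono)
  ultimately obtain t where t: "P t" and max: "\<And>s. P s \<Longrightarrow> card (nodes s) \<le> card (nodes t)"
    using ex_has_greatest_nat[of P "Node v []" "\<lambda>t. card (nodes t)" "Suc (card (pverts T))"] by blast
  have dt: "distinct_nodes t" and rt: "root t = v" and nt: "nodes t \<subseteq> pverts T"
    and pt: "parent_rel t \<subseteq> parcs T" using t by (auto simp: P_def)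
  have closed: "y \<in> nodes t" if "(x, y) \<in> parcs T" "x \<in> nodes t" for x y
  proof (rule ccontr)
    assume y: "y \<notin> nodes t"
    have "y \<in> pverts T" using T.in_arcsD2[OF that(1)] .
    then have "P (insert_leaf x y t)"
      using dt rt nt pt that y
      by (auto simp: P_def nodes_insert_leaf parent_rel_insert_leaf distinct_nodes_insert_leaf)
    from max[OF this] show False using that y by (simp add: nodes_insert_leaf)
  qed
  have nodes_t: "nodes t = pverts T"
  proof (intro equalityI nt subsetI)
    fix z assume z: "z \<in> pverts T"
    have "strongly_connected (with_proj T)"
      using T.symmetric_connected_imp_strongly_connected[OF T.pair_sym_arcs conn] .
    then have "v \<rightarrow>\<^sup>*\<^bsub>with_proj T\<^esub> z" using v z by (auto simp: strongly_connected_def)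
    then have "(v, z) \<in> (arcs_ends (with_proj T))\<^sup>*" by (rule reachable_rtranclI)
    then have "(v, z) \<in> (parcs T)\<^sup>*" by simp
    then show "z \<in> nodes t"
      by (induction rule: rtrancl_induct) (use rt closed root_in_nodes[of t] in auto)
  qed
  interpret H: pair_wf_digraph "tree_graph t" by (rule pair_wf_digraph_tree_graph)
  have sub: "parcs (tree_graph t) \<subseteq> parcs T"
    using pt T.arcs_symmetric by (auto simp: tree_graph_def)
  have "parcs T \<subseteq> parcs (tree_graph t)"
  proof (rule subrelI, rule ccontr)
    fix x y assume xy: "(x, y) \<in> parcs T" "(x, y) \<notin> parcs (tree_graph t)"
    have n: "x \<in> nodes t" "y \<in> nodes t" using T.in_arcsD1 T.in_arcsD2 xy nodes_t by auto
    have "x \<noteq> y" using T.no_loops'[OF xy(1)] .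
    have reach: "(v, z) \<in> (parcs (tree_graph t))\<^sup>*" "(z, v) \<in> (parcs (tree_graph t))\<^sup>*"
      if "z \<in> nodes t" for z
    proof -
      have "(v, z) \<in> (parent_rel t)\<^sup>*" using root_reaches_nodes[OF that] rt by simp
      then show "(v, z) \<in> (parcs (tree_graph t))\<^sup>*" "(z, v) \<in> (parcs (tree_graph t))\<^sup>*"
        using rtrancl_mono[of "parent_rel t" "parcs (tree_graph t)"]
          rtrancl_mono[of "(parent_rel t)\<inverse>" "parcs (tree_graph t)"]
          rtrancl_converseI[of v z "parent_rel t"]
        by (auto simp: tree_graph_def)
    qed
    have "(x, y) \<in> (parcs (tree_graph t))\<^sup>*"
      using rtrancl_trans[OF reach(2)[OF n(1)] reach(1)[OF n(2)]] .
    then have "(x, y) \<in> (parcs (tree_graph t))\<^sup>+" using \<open>x \<noteq> y\<close> by (auto simp: rtrancl_eq_or_trancl)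
    then have "x \<rightarrow>\<^sup>*\<^bsub>with_proj (tree_graph t)\<^esub> y"
      by (intro H.reachable1_reachable) simp
    then obtain p where p: "H.apath x p y" by (auto simp: H.reachable_apath)
    have ap: "H.awalk x p y" "distinct (pawalk_verts x p)" using p by (auto simp: H.apath_def)
    \<comment> \<open>The path is neither empty nor a single edge, so closing it with
      \<open>(y, x)\<close> gives a cycle of length at least 3.\<close>
    have len: "2 \<le> length p"
    proof (cases p)
      case Nil
      then show ?thesis using ap(1) \<open>x \<noteq> y\<close> by (auto simp: H.awalk_Nil_iff)
    next
      case (Cons e p')
      then have "p' \<noteq> []" using ap(1) xy(2) by (cases e) (auto simp: H.awalk_simps)
      then show ?thesis using Cons by (cases p') auto
    qed
    have "T.awalk x p y"
      using ap(1) sub T.in_arcsD1[OF xy(1)] unfolding H.awalk_def T.awalk_def by blast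
    then have "T.awalk y ((y, x) # p) y"
      using T.arcs_symmetric[OF xy(1)] T.in_arcsD2[OF xy(1)] by (auto simp: T.awalk_simps)
    then have "T.cycle ((y, x) # p)"
      using ap(2) unfolding T.cycle_def by auto
    with no_cycle len show False by force
  qed
  with sub nodes_t have "T = tree_graph t"
    by (intro pair_pre_digraph.equality) (simp_all add: tree_graph_def subset_antisym)
  with dt rt that show ?thesis by blast
qed

section \<open>Logarithmic bound on the levels\<close>

text \<open>This makes the ratio of the logarithms at least 1, so that it absorbs additive
  constants.\<close>

lemma max_degree_le_card:
  assumes "rooted_tree T v"
  shows "max_degree T \<le> card (pverts T)"
proof -
  from assms have "pair_graph T" and v: "v \<in> pverts T"
    by (auto simp: rooted_tree_def undirected_tree_def)
  interpret T: pair_graph T by fact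
  have "out_degree (with_proj T) w \<le> card (pverts T)" for w
  proof -
    have "out_arcs (with_proj T) w \<subseteq> Pair w ` pverts T"
      using T.in_arcsD2 by (auto simp: out_arcs_def)
    then have "out_degree (with_proj T) w \<le> card (Pair w ` pverts T)"
      unfolding out_degree_def using T.pair_finite_verts by (intro card_mono) auto
    also have "\<dots> = card (pverts T)" by (rule card_image) (auto simp: inj_on_def)
    finally show ?thesis .
  qed
  then show ?thesis
    unfolding max_degree_def using v T.pair_finite_verts by (intro Max.boundedI) auto
qed

lemma level_le:
  assumes "is_level P h" "P k" "\<And>i j. i \<le> j \<Longrightarrow> P i \<Longrightarrow> P j"
  shows "h \<le> k"
proof (rule ccontr)
  assume "\<not> h \<le> k"
  then have "h \<noteq> 0" "k \<le> h - 1" by auto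
  with assms show False by (auto simp: is_level_def)
qed

lemma level_le_log:
  fixes D n h :: nat
  assumes D: "2 \<le> D" "D \<le> n" and h: "h \<le> D + 2"
    and small: "\<And>k. 400 \<le> D \<Longrightarrow> 8 * k \<le> D \<Longrightarrow> n * 20 ^ k < D ^ k \<Longrightarrow> h \<le> 2 * k"
  shows "real h \<le> 402 * (ln (real n) / ln (real D))"
proof -
  define x where "x = ln (real n) / ln (real D)"
  have x: "1 \<le> x" using D by (simp add: x_def)
  show ?thesis
  proof (cases "D < 400")
    case True
    then have "real h \<le> 402" using h by linarith
    with x show ?thesis unfolding x_def by linarith
  next
    case False
    \<comment> \<open>The minimum ensures \<open>8 * k \<le> D\<close>, and \<open>2 * k < h\<close>
      for \<open>h > 0\<close>, so \<open>small\<close> fails at \<open>k\<close>. From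
      \<open>h \<le> D + 2\<close> follows \<open>h \<le> 8 * k + 10\<close>, so bounding
      \<open>k\<close> suffices.\<close>
    define k where "k = min ((h - 1) div 2) (D div 8)"
    have "D ^ k \<le> n * 20 ^ k"
    proof (cases "h = 0")
      case True
      then show ?thesis using D by (simp add: k_def)
    next
      case h0: False
      have "\<not> h \<le> 2 * k" unfolding k_def using h0 by linarith
      moreover have "8 * k \<le> D" unfolding k_def by linarith
      ultimately have "\<not> n * 20 ^ k < D ^ k" using small[of k] False by auto
      then show ?thesis by (rule leI)
    qed
    then have "real (D ^ k) \<le> real (n * 20 ^ k)" by (rule of_nat_mono)
    then have "real D ^ k \<le> real n * 20 ^ k" by simp
    then have "ln (real D ^ k) \<le> ln (real n * 20 ^ k)" using D by (subst ln_le_cancel_iff) auto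
    then have "real k * ln D \<le> ln n + real k * ln 20"
      using D by (simp add: ln_mult ln_realpow)
    \<comment> \<open>By \<open>400 = 20 ^ 2\<close>, the factor \<open>20 ^ k\<close> costs at most
      half of \<open>k * ln D\<close>.\<close>
    moreover have "2 * ln (20::real) \<le> ln D"
    proof -
      have "2 * ln (20::real) = ln (20 ^ 2)" by (simp only: ln_realpow)
      also have "\<dots> \<le> ln D" using False by (subst ln_le_cancel_iff) auto
      finally show ?thesis .
    qed
    then have "real k * (2 * ln 20) \<le> real k * ln D" by (intro mult_left_mono) auto
    ultimately have "real k * ln D \<le> 2 * ln n" by linarith
    then have kx: "real k \<le> 2 * x"
      using D by (simp add: x_def field_simps)
    have "h \<le> 8 * k + 10" using h unfolding k_def by linarith
    then have "real h \<le> 8 * real k + 10" by linarith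
    also have "\<dots> \<le> 402 * x" using kx x by linarith
    finally show ?thesis by (simp add: x_def)
  qed
qed

theorem theorem3p3:
  "\<exists>C::real. C > 0 \<and>
     (\<forall>(T :: 'a pair_pre_digraph) v u.
        rooted_tree T v \<longrightarrow> u \<notin> pverts T \<longrightarrow> max_degree T \<ge> 2 \<longrightarrow>
          real (head_level (max_degree T) T u v)
            \<le> C * (ln (real (card (pverts T))) / ln (real (max_degree T))) \<and>
          real (neck_level (max_degree T) T u v)
            \<le> C * (ln (real (card (pverts T))) / ln (real (max_degree T))))"
proof (intro exI[of _ 402] conjI allI impI)
  fix T :: "'a pair_pre_digraph" and v u
  assume T: "rooted_tree T v" and u: "u \<notin> pverts T" and deg: "max_degree T \<ge> 2"
  define D where "D = max_degree T"
  have Dn: "2 \<le> D" "D \<le> card (pverts T)" using deg max_degree_le_card[OF T] by (auto simp: D_def)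
  obtain t where t: "distinct_nodes t" "root t = v" "T = tree_graph t"
    using exists_tree_graph[OF T] .
  have nodes: "pverts T = nodes t" by (simp add: t tree_graph_def)
  have delta: "delta D T u v a b = (if a \<le> D + 1 \<and> extends D t a b then 1 else 0)" for a b
    using delta_tree_graph[OF t(1), of u D a b] u t(2,3) nodes by simp
  have le: "a \<le> D + 1" if "a \<in> L_set D i" for a i using that by (auto simp: L_set_def)
  have small: "head_compatible D T u v (2 * k) \<and> neck_compatible D T u v (2 * k)"
    if "400 \<le> D" "8 * k \<le> D" "card (pverts T) * 20 ^ k < D ^ k" for k
  proof -
    have comp: "head_comp D (2 * k) t" "neck_comp D (2 * k) t"
      using small_tree_comp[of D k t] that card_nodes[OF t(1)] nodes by auto
    have "head_compatible D T u v (2 * k)"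
      unfolding head_compatible_def delta apart_2_iff[symmetric]
      using comp(1) le unfolding head_comp_def by metis
    moreover have "neck_compatible D T u v (2 * k)"
      unfolding neck_compatible_def delta apart_2_iff[symmetric]
      using comp(2) unfolding neck_comp_def by metis
    ultimately show ?thesis by simp
  qed
  have head: "head_level D T u v \<le> k" if "head_compatible D T u v k" for k
    unfolding head_level_def
    using theI'[OF ex1_head_level] that
  proof (rule level_le)
    show "head_compatible D T u v j" if "i \<le> j" "head_compatible D T u v i" for i j
      using that(2) L_set_antimono[OF that(1), of D] unfolding head_compatible_def by blast
  qed
  have neck: "neck_level D T u v \<le> k" if "neck_compatible D T u v k" for k
    unfolding neck_level_def
    using theI'[OF ex1_neck_level] that
  proof (rule level_le)
    show "neck_compatible D T u v j" if "i \<le> j" "neck_compatible D T u v i" for i j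
      using that(2) L_set_antimono[OF that(1), of D] unfolding neck_compatible_def by blast
  qed
  \<comment> \<open>The trivial bound on both levels: \<open>L_set D (D + 2)\<close> is
    empty.\<close>
  have "head_compatible D T u v (D + 2)" "neck_compatible D T u v (D + 2)"
    unfolding head_compatible_def neck_compatible_def L_set_empty by simp_all
  then have "head_level D T u v \<le> D + 2" "neck_level D T u v \<le> D + 2" using head neck by blast+
  note le_D = this
  show "real (head_level (max_degree T) T u v)
      \<le> 402 * (ln (real (card (pverts T))) / ln (real (max_degree T)))"
    unfolding D_def[symmetric] by (rule level_le_log[OF Dn le_D(1)]) (simp add: head small)
  show "real (neck_level (max_degree T) T u v)
      \<le> 402 * (ln (real (card (pverts T))) / ln (real (max_degree T)))"
    unfolding D_def[symmetric] by (rule level_le_log[OF Dn le_D(2)]) (simp add: neck small)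
qed simp

end
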